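(* Let $G$ be a group, let $S$ and $T$ be $G$-sets, and let $\rho\colon\mathbb{Z}[S]\to\mathbb{Z}[T]$ be a morphism of $\mathbb{Z}G$-modules. Suppose that the orbit sets $S/G$ and $T/G$ are finite, that the $G$-stabilizer of $t$ is finite for every $t\in T$, and that $\ker\rho$ is finitely generated as a $\mathbb{Z}G$-module. Then $\mathrm{FV}_\rho(n)<\infty$ for all $n\in\mathbb{N}$.
   Context: For a $G$-set $S$, $\mathbb{Z}[S]$ is the free abelian group on $S$ with the induced $\mathbb{Z}G$-module structure (the permutation module on $S$), and $\|\sum_{s\in S}n_s s\|_S=\sum_{s\in S}|n_s|$ is its $\ell_1$-norm. Filling norms: if $F$ is a finitely generated free $\mathbb{Z}G$-module with a chosen finite $\mathbb{Z}G$-basis $\{\alpha_i : i\in I\}$, then $\|\cdot\|_F$ denotes the $\ell_1$-norm with respect to the $\mathbb{Z}$-basis $\{g\alpha_i : g\in G, i\in I\}$. If $\eta\colon F\to K$ is a surjective morphism of $\mathbb{Z}G$-modules, where $F$ is a finitely generated free $\mathbb{Z}G$-module with a chosen finite $\mathbb{Z}G$-basis $\{\alpha_i : i\in I\}$ and $\|\cdot\|_F$ is the $\ell_1$-norm with respect to the $\mathbb{Z}$-basis $\{g\alpha_i : g\in G, i\in I\}$, the induced filling norm on $K$ is $\|m\|_\eta=\min\{\|x\|_F : x\in F,\ \eta(x)=m\}$. A filling norm on $K$ is any norm arising in this way. For a morphism $\rho\colon\mathbb{Z}[S]\to\mathbb{Z}[T]$ of permutation $\mathbb{Z}G$-modules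 whose kernel $K=\ker\rho$ is finitely generated, let $\|\cdot\|_K$ be a (any chosen) filling norm on $K$ and define $\mathrm{FV}_\rho\colon\mathbb{N}\to\mathbb{N}\cup\{\infty\}$ by $$\mathrm{FV}_\rho(n)=\sup\{\|x\|_K : x\in K,\ \|x\|_S\le n\}.$$ *)

theory Defs
  imports
    "HOL-Algebra.Module"
    "HOL-Algebra.AbelCoset"
    "HOL-Algebra.Group_Action"
    "HOL-Algebra.Free_Abelian_Groups"
    "HOL-Library.Extended_Nat"
begin

section \<open>Left modules over a not necessarily commutative ring\<close>

text \<open>The library locale \<open>module\<close> assumes a commutative ring of scalars.\<close>

locale left_module = R?: ring R + M?: abelian_group M
  for R (structure) and M (structure) +
  assumes smult_closed:
      "\<lbrakk>a \<in> carrier R; x \<in> carrier M\<rbrakk> \<Longrightarrow> a \<odot>\<^bsub>M\<^esub> x \<in> carrier M"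
    and smult_l_distr:
      "\<lbrakk>a \<in> carrier R; b \<in> carrier R; x \<in> carrier M\<rbrakk> \<Longrightarrow>
        (a \<oplus> b) \<odot>\<^bsub>M\<^esub> x = a \<odot>\<^bsub>M\<^esub> x \<oplus>\<^bsub>M\<^esub> b \<odot>\<^bsub>M\<^esub> x"
    and smult_r_distr:
      "\<lbrakk>a \<in> carrier R; x \<in> carrier M; y \<in> carrier M\<rbrakk> \<Longrightarrow>
        a \<odot>\<^bsub>M\<^esub> (x \<oplus>\<^bsub>M\<^esub> y) = a \<odot>\<^bsub>M\<^esub> x \<oplus>\<^bsub>M\<^esub> a \<odot>\<^bsub>M\<^esub> y"
    and smult_assoc:
      "\<lbrakk>a \<in> carrier R; b \<in> carrier R; x \<in> carrier M\<rbrakk> \<Longrightarrow>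
        (a \<otimes> b) \<odot>\<^bsub>M\<^esub> x = a \<odot>\<^bsub>M\<^esub> (b \<odot>\<^bsub>M\<^esub> x)"
    and smult_one: "x \<in> carrier M \<Longrightarrow> \<one> \<odot>\<^bsub>M\<^esub> x = x"

definition left_module_hom ::
  "('r, 'k) ring_scheme \<Rightarrow> ('r, 'a, 'm) module_scheme \<Rightarrow> ('r, 'b, 'n) module_scheme \<Rightarrow> ('a \<Rightarrow> 'b) set"
  where "left_module_hom R M N = {h \<in> carrier M \<rightarrow> carrier N.
    (\<forall>x\<in>carrier M. \<forall>y\<in>carrier M. h (x \<oplus>\<^bsub>M\<^esub> y) = h x \<oplus>\<^bsub>N\<^esub> h y) \<and>
    (\<forall>a\<in>carrier R. \<forall>x\<in>carrier M. h (a \<odot>\<^bsub>M\<^esub> x) = a \<odot>\<^bsub>N\<^esub> h x)}"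

definition fin_gen_module :: "('r, 'k) ring_scheme \<Rightarrow> ('r, 'a, 'm) module_scheme \<Rightarrow> bool"
  where "fin_gen_module R M \<longleftrightarrow> (\<exists>X. finite X \<and> X \<subseteq> carrier M \<and>
    (\<forall>m\<in>carrier M. \<exists>a\<in>X \<rightarrow> carrier R. m = (\<Oplus>\<^bsub>M\<^esub>x\<in>X. a x \<odot>\<^bsub>M\<^esub> x)))"

text \<open>Finite bases only: \<open>finsum\<close> does not give the sum over an infinite index set.\<close>

definition finite_basis ::
  "('r, 'k) ring_scheme \<Rightarrow> ('r, 'a, 'm) module_scheme \<Rightarrow> 'i set \<Rightarrow> ('i \<Rightarrow> 'a) \<Rightarrow> bool"
  where "finite_basis R F I \<alpha> \<longleftrightarrow> finite I \<and> \<alpha> \<in> I \<rightarrow> carrier F \<and>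
    (\<forall>m\<in>carrier F. \<exists>!a. a \<in> I \<rightarrow>\<^sub>E carrier R \<and> m = (\<Oplus>\<^bsub>F\<^esub>i\<in>I. a i \<odot>\<^bsub>F\<^esub> \<alpha> i))"

definition kernel_module ::
  "('r, 'a, 'm) module_scheme \<Rightarrow> ('r, 'b, 'n) module_scheme \<Rightarrow> ('a \<Rightarrow> 'b) \<Rightarrow> ('r, 'a, 'm) module_scheme"
  where "kernel_module M N h = M\<lparr>carrier := a_kernel M N h\<rparr>"


section \<open>Group rings and permutation modules\<close>

text \<open>The \<open>\<int>\<close>-bilinear extension of an operation on generators.\<close>

definition frag_bilinear ::
  "('a \<Rightarrow> 'b \<Rightarrow> 'c) \<Rightarrow> ('a \<Rightarrow>\<^sub>0 int) \<Rightarrow> ('b \<Rightarrow>\<^sub>0 int) \<Rightarrow> ('c \<Rightarrow>\<^sub>0 int)"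
  where "frag_bilinear f a x = frag_extend (\<lambda>g. frag_extend (\<lambda>s. frag_of (f g s)) x) a"

definition group_ring :: "('g, 'k) monoid_scheme \<Rightarrow> ('g \<Rightarrow>\<^sub>0 int) ring"
  where "group_ring G =
    \<lparr>carrier = carrier (free_Abelian_group (carrier G)),
     mult = frag_bilinear (\<lambda>g h. g \<otimes>\<^bsub>G\<^esub> h), one = frag_of \<one>\<^bsub>G\<^esub>, ring.zero = 0, add = (+)\<rparr>"

text \<open>The fields \<open>mult\<close> and \<open>one\<close>, inherited from the record of rings, play no role in a module.\<close>

definition permutation_module :: "'s set \<Rightarrow> ('g \<Rightarrow> 's \<Rightarrow> 's) \<Rightarrow> ('g \<Rightarrow>\<^sub>0 int, 's \<Rightarrow>\<^sub>0 int) module"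
  where "permutation_module S \<phi> =
    \<lparr>carrier = carrier (free_Abelian_group S),
     mult = undefined, one = undefined, ring.zero = 0, add = (+), smult = frag_bilinear \<phi>\<rparr>"


section \<open>Norms and the filling function\<close>

definition l1_norm :: "('s \<Rightarrow>\<^sub>0 int) \<Rightarrow> nat"
  where "l1_norm x = (\<Sum>s\<in>Poly_Mapping.keys x. nat \<bar>Poly_Mapping.lookup x s\<bar>)"

text \<open>Coordinates with respect to a \<open>\<int>\<close>-basis \<open>b\<close> indexed by \<open>J\<close>, and the
  \<open>\<int>\<close>-basis \<open>g \<alpha>\<^sub>i\<close> of a free module over the group ring with basis \<open>\<alpha>\<close>.\<close>

definition int_coords :: "('r, 'a, 'm) module_scheme \<Rightarrow> 'j set \<Rightarrow> ('j \<Rightarrow> 'a) \<Rightarrow> 'a \<Rightarrow> ('j \<Rightarrow>\<^sub>0 int)"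
  where "int_coords F J b x = (THE c. c \<in> carrier (free_Abelian_group J) \<and>
    x = (\<Oplus>\<^bsub>F\<^esub>j\<in>Poly_Mapping.keys c. [Poly_Mapping.lookup c j] \<cdot>\<^bsub>F\<^esub> b j))"

definition free_norm ::
  "('g, 'k) monoid_scheme \<Rightarrow> ('g \<Rightarrow>\<^sub>0 int, 'a, 'm) module_scheme \<Rightarrow> 'i set \<Rightarrow> ('i \<Rightarrow> 'a) \<Rightarrow> 'a \<Rightarrow> nat"
  where "free_norm G F I \<alpha> x =
    l1_norm (int_coords F (carrier G \<times> I) (\<lambda>(g, i). frag_of g \<odot>\<^bsub>F\<^esub> \<alpha> i) x)"

definition filling_norm ::
  "('g, 'k) monoid_scheme \<Rightarrow> ('g \<Rightarrow>\<^sub>0 int, 'a, 'm) module_scheme \<Rightarrow> 'i set \<Rightarrow> ('i \<Rightarrow> 'a) \<Rightarrow>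
    ('a \<Rightarrow> 'b) \<Rightarrow> 'b \<Rightarrow> nat"
  where "filling_norm G F I \<alpha> \<eta> m =
    (LEAST n. \<exists>x\<in>carrier F. \<eta> x = m \<and> n = free_norm G F I \<alpha> x)"

text \<open>The argument \<open>\<nu>\<close> is the chosen filling norm on the kernel of \<open>\<rho> : M \<rightarrow> N\<close>.\<close>

definition FV ::
  "('r, 's \<Rightarrow>\<^sub>0 int, 'm) module_scheme \<Rightarrow> ('r, 't \<Rightarrow>\<^sub>0 int, 'n) module_scheme \<Rightarrow>
    (('s \<Rightarrow>\<^sub>0 int) \<Rightarrow> ('t \<Rightarrow>\<^sub>0 int)) \<Rightarrow> (('s \<Rightarrow>\<^sub>0 int) \<Rightarrow> nat) \<Rightarrow> nat \<Rightarrow> enat"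
  where "FV M N \<rho> \<nu> n =
    (SUP x\<in>{x \<in> carrier (kernel_module M N \<rho>). l1_norm x \<le> n}. enat (\<nu> x))"


section \<open>The group ring is a ring; permutation modules and kernels are modules\<close>

lemma frag_bilinear_of [simp]: "frag_bilinear f (frag_of g) (frag_of s) = frag_of (f g s)"
  by (simp add: frag_bilinear_def)

lemma frag_bilinear_0 [simp]: "frag_bilinear f 0 x = 0" "frag_bilinear f a 0 = 0"
  by (simp_all add: frag_bilinear_def frag_extend_eq_0)

lemma frag_bilinear_diff_left:
  "frag_bilinear f (a - b) x = frag_bilinear f a x - frag_bilinear f b x"
  by (simp add: frag_bilinear_def frag_extend_diff)

lemma frag_bilinear_add_left:
  "frag_bilinear f (a + b) x = frag_bilinear f a x + frag_bilinear f b x"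
  by (simp add: frag_bilinear_def frag_extend_add)

lemma frag_bilinear_add_right:
  "frag_bilinear f a (x + y) = frag_bilinear f a x + frag_bilinear f a y"
  unfolding frag_bilinear_def frag_extend_add frag_extend_def[of _ a]
  by (simp add: frag_cmul_distrib2 sum.distrib)

lemma frag_bilinear_diff_right:
  "frag_bilinear f a (x - y) = frag_bilinear f a x - frag_bilinear f a y"
  using frag_bilinear_add_right[of f a "x - y" y] by simp

lemma keys_frag_bilinear:
  assumes "Poly_Mapping.keys a \<subseteq> A" "Poly_Mapping.keys x \<subseteq> X"
    and "\<And>g s. g \<in> A \<Longrightarrow> s \<in> X \<Longrightarrow> f g s \<in> Y"
  shows "Poly_Mapping.keys (frag_bilinear f a x) \<subseteq> Y"
proof -
  have 1: "Poly_Mapping.keys (frag_extend (\<lambda>s. frag_of (f g s)) x) \<subseteq> Y" if "g \<in> A" for g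
    using keys_frag_extend[of "\<lambda>s. frag_of (f g s)" x] assms that by fastforce
  show ?thesis
    unfolding frag_bilinear_def
    using keys_frag_extend[of "\<lambda>g. frag_extend (\<lambda>s. frag_of (f g s)) x" a] 1 assms(1) by blast
qed

lemma frag_bilinear_assoc:
  assumes "Poly_Mapping.keys a \<subseteq> A" "Poly_Mapping.keys b \<subseteq> A" "Poly_Mapping.keys x \<subseteq> X"
    and "\<And>g h s. g \<in> A \<Longrightarrow> h \<in> A \<Longrightarrow> s \<in> X \<Longrightarrow> f (m g h) s = f g (f h s)"
  shows "frag_bilinear f (frag_bilinear m a b) x = frag_bilinear f a (frag_bilinear f b x)"
  using assms(1)
proof (induction a rule: frag_induction)
  case (one g)
  note g = this
  show ?case
    using assms(2)
  proof (induction b rule: frag_induction)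
    case (one h)
    note h = this
    show ?case
      using assms(3)
      by (induction x rule: frag_induction)
        (simp_all add: frag_bilinear_diff_left frag_bilinear_diff_right assms(4) g h)
  qed (simp_all add: frag_bilinear_diff_left frag_bilinear_diff_right)
qed (simp_all add: frag_bilinear_diff_left)

lemma frag_bilinear_left_id:
  assumes "Poly_Mapping.keys x \<subseteq> X" "\<And>s. s \<in> X \<Longrightarrow> f e s = s"
  shows "frag_bilinear f (frag_of e) x = x"
  using assms(1)
  by (induction x rule: frag_induction) (simp_all add: frag_bilinear_diff_right assms(2))

lemma frag_bilinear_right_id:
  assumes "Poly_Mapping.keys x \<subseteq> X" "\<And>s. s \<in> X \<Longrightarrow> f s e = s"
  shows "frag_bilinear f x (frag_of e) = x"
  using assms(1)
  by (induction x rule: frag_induction) (simp_all add: frag_bilinear_diff_left assms(2))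

lemma abelian_group_frag:
  assumes "carrier M = carrier (free_Abelian_group S)" "\<zero>\<^bsub>M\<^esub> = 0" "add M = (+)"
  shows "abelian_group M"
proof (rule abelian_groupI)
  fix x y assume "x \<in> carrier M" "y \<in> carrier M"
  then show "x \<oplus>\<^bsub>M\<^esub> y \<in> carrier M"
    using keys_add[of x y] by (auto simp: assms)
next
  fix x assume "x \<in> carrier M"
  then show "\<exists>y\<in>carrier M. y \<oplus>\<^bsub>M\<^esub> x = \<zero>\<^bsub>M\<^esub>"
    by (intro bexI[of _ "- x"]) (auto simp: assms)
qed (auto simp: assms algebra_simps)

lemma ring_group_ring:
  assumes "group G"
  shows "ring (group_ring G)"
proof -
  interpret group G by fact
  show ?thesis
  proof (rule ringI)
    show "abelian_group (group_ring G)"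
      by (rule abelian_group_frag[of _ "carrier G"]) (simp_all add: group_ring_def)
    show "monoid (group_ring G)"
    proof (rule monoidI)
      fix x y z
      assume "x \<in> carrier (group_ring G)" "y \<in> carrier (group_ring G)" "z \<in> carrier (group_ring G)"
      then show "x \<otimes>\<^bsub>group_ring G\<^esub> y \<otimes>\<^bsub>group_ring G\<^esub> z = x \<otimes>\<^bsub>group_ring G\<^esub> (y \<otimes>\<^bsub>group_ring G\<^esub> z)"
        by (simp add: group_ring_def frag_bilinear_assoc[of _ "carrier G" _ _ "carrier G"] m_assoc)
    next
      fix x y
      assume "x \<in> carrier (group_ring G)" "y \<in> carrier (group_ring G)"
      then show "x \<otimes>\<^bsub>group_ring G\<^esub> y \<in> carrier (group_ring G)"
        by (simp add: group_ring_def keys_frag_bilinear[of _ "carrier G" _ "carrier G"])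
    qed (simp_all add: group_ring_def keys_frag_of frag_bilinear_left_id[of _ "carrier G"]
          frag_bilinear_right_id[of _ "carrier G"])
  qed (simp_all add: group_ring_def frag_bilinear_add_left frag_bilinear_add_right)
qed

lemma left_module_permutation_module:
  assumes "group_action G S \<phi>"
  shows "left_module (group_ring G) (permutation_module S \<phi>)"
proof -
  interpret group_action G S \<phi> by fact
  have G: "group G"
    using group_hom by (simp add: group_hom_def)
  have closed: "\<phi> g s \<in> S" if "g \<in> carrier G" "s \<in> S" for g s
    using element_image that by blast
  have mult: "\<phi> (g \<otimes>\<^bsub>G\<^esub> h) s = \<phi> g (\<phi> h s)" if "g \<in> carrier G" "h \<in> carrier G" "s \<in> S" for g h s
    using composition_rule that by blast
  have one: "\<phi> \<one>\<^bsub>G\<^esub> s = s" if "s \<in> S" for s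
    using id_eq_one that by (metis restrict_apply')
  show ?thesis
  proof (rule left_module.intro[OF ring_group_ring[OF G]])
    show "abelian_group (permutation_module S \<phi>)"
      by (rule abelian_group_frag[of _ S]) (simp_all add: permutation_module_def)
    show "left_module_axioms (group_ring G) (permutation_module S \<phi>)"
      by unfold_locales
        (simp_all add: group_ring_def permutation_module_def frag_bilinear_add_left
          frag_bilinear_add_right frag_bilinear_left_id[of _ S] one closed mult
          keys_frag_bilinear[of _ "carrier G" _ S] frag_bilinear_assoc[of _ "carrier G" _ _ S])
  qed
qed

lemma left_module_kernel_module:
  assumes "left_module R M" "left_module R N" "h \<in> left_module_hom R M N"
  shows "left_module R (kernel_module M N h)"
proof -
  interpret M: left_module R M by fact
  interpret N: left_module R N by fact
  have add: "h (x \<oplus>\<^bsub>M\<^esub> y) = h x \<oplus>\<^bsub>N\<^esub> h y" if "x \<in> carrier M" "y \<in> carrier M" for x y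
    using assms(3) that by (auto simp: left_module_hom_def)
  have smult: "h (a \<odot>\<^bsub>M\<^esub> x) = a \<odot>\<^bsub>N\<^esub> h x" if "a \<in> carrier R" "x \<in> carrier M" for a x
    using assms(3) that by (auto simp: left_module_hom_def)
  have closed: "h x \<in> carrier N" if "x \<in> carrier M" for x
    using assms(3) that by (auto simp: left_module_hom_def)
  have h0: "h \<zero>\<^bsub>M\<^esub> = \<zero>\<^bsub>N\<^esub>"
    using add[of "\<zero>\<^bsub>M\<^esub>" "\<zero>\<^bsub>M\<^esub>"] closed[of "\<zero>\<^bsub>M\<^esub>"] by simp
  have hneg: "h (\<ominus>\<^bsub>M\<^esub> x) = \<zero>\<^bsub>N\<^esub>" if "x \<in> carrier M" "h x = \<zero>\<^bsub>N\<^esub>" for x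
    using add[of "\<ominus>\<^bsub>M\<^esub> x" x] closed[of "\<ominus>\<^bsub>M\<^esub> x"] that h0 by (simp add: M.l_neg)
  have s0: "a \<odot>\<^bsub>N\<^esub> \<zero>\<^bsub>N\<^esub> = \<zero>\<^bsub>N\<^esub>" if "a \<in> carrier R" for a
    using N.smult_r_distr[of a "\<zero>\<^bsub>N\<^esub>" "\<zero>\<^bsub>N\<^esub>"] N.smult_closed[of a "\<zero>\<^bsub>N\<^esub>"] that by simp
  have "abelian_group (kernel_module M N h)"
  proof (rule abelian_groupI)
    fix x assume "x \<in> carrier (kernel_module M N h)"
    then show "\<exists>y\<in>carrier (kernel_module M N h).
        y \<oplus>\<^bsub>kernel_module M N h\<^esub> x = \<zero>\<^bsub>kernel_module M N h\<^esub>"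
      by (intro bexI[of _ "\<ominus>\<^bsub>M\<^esub> x"]) (auto simp: kernel_module_def a_kernel_def' hneg M.l_neg)
  qed (auto simp: kernel_module_def a_kernel_def' add h0 M.a_assoc intro: M.a_comm)
  moreover have "left_module_axioms R (kernel_module M N h)"
    by unfold_locales
      (simp_all add: kernel_module_def a_kernel_def' M.smult_closed smult s0 M.smult_l_distr
        M.smult_r_distr M.smult_assoc M.smult_one)
  ultimately show ?thesis
    by (intro left_module.intro M.R.ring_axioms)
qed

end

theory Submission
  imports Defs
begin

text \<open>
  Call elements of the kernel \<open>K\<close> of \<open>\<rho>\<close> cycles. A filling norm on \<open>K\<close> is subadditive and does not
  grow under translation by \<open>G\<close> (\<open>filling_norm_add_le\<close>, \<open>filling_norm_translate_le\<close>), so it suffices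
  to write every cycle of norm at most \<open>n\<close> as a sum of at most \<open>n\<close> translates of cycles from one
  finite set.

  For this, join \<open>s\<close> and \<open>s'\<close> in \<open>S\<close> by an edge when the supports of \<open>\<rho> s\<close> and \<open>\<rho> s'\<close> meet. The
  part of a cycle \<open>x\<close> that lies over a connected component of its support is again a cycle, since
  the images of the components have disjoint supports and add up to zero (\<open>split_cycle\<close>). The
  graph is locally finite: a given \<open>t\<close> in \<open>T\<close> lies in the support of \<open>\<rho> (g r)\<close> only if \<open>g\<close> moves
  one of the finitely many points of the support of \<open>\<rho> r\<close> to \<open>t\<close>; as stabilizers in \<open>T\<close> are
  finite, this leaves finitely many \<open>g\<close> for each of the finitely many orbit representatives \<open>r\<close>
  (\<open>finite_thicken\<close>). Points with infinite stabilizer in \<open>S\<close> cause no trouble, because what is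
  counted are the elements \<open>g r\<close> and only those with \<open>\<rho> (g r) \<noteq> 0\<close>.

  After a translation, the support of \<open>x\<close> meets the finite set \<open>R\<close> of orbit representatives. The
  balls around \<open>R\<close> cut out an increasing sequence of subsets of that support, which has at most
  \<open>n\<close> points, so some ball of radius \<open>k \<le> n\<close> cuts out a union of components of it
  (\<open>thicken_stabilises\<close>). The corresponding summand of \<open>x\<close> is a nonzero cycle of norm at most \<open>n\<close>
  with support in a fixed finite set, and there are only finitely many of these. What remains of
  \<open>x\<close> has smaller norm, and induction on \<open>n\<close> gives the bound (\<open>bounded_on_l1_balls\<close>).
\<close>

section \<open>The l1-norm\<close>

lemma l1_norm_eq_sum:
  assumes "finite A" "Poly_Mapping.keys x \<subseteq> A"
  shows "l1_norm x = (\<Sum>s\<in>A. nat \<bar>Poly_Mapping.lookup x s\<bar>)"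
  unfolding l1_norm_def
  by (rule sum.mono_neutral_left) (use assms in \<open>auto simp: in_keys_iff\<close>)

lemma l1_norm_eq_0_iff [simp]: "l1_norm x = 0 \<longleftrightarrow> x = 0"
  by (auto simp: l1_norm_def in_keys_iff simp flip: keys_eq_empty)

lemma l1_norm_add_le: "l1_norm (x + y) \<le> l1_norm x + l1_norm y"
proof -
  let ?A = "Poly_Mapping.keys x \<union> Poly_Mapping.keys y"
  have "l1_norm (x + y) = (\<Sum>s\<in>?A. nat \<bar>Poly_Mapping.lookup (x + y) s\<bar>)"
    by (intro l1_norm_eq_sum keys_add) simp
  also have "\<dots> \<le> (\<Sum>s\<in>?A. nat \<bar>Poly_Mapping.lookup x s\<bar> + nat \<bar>Poly_Mapping.lookup y s\<bar>)"
    by (intro sum_mono) (simp add: lookup_add)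
  also have "\<dots> = l1_norm x + l1_norm y"
    by (simp add: sum.distrib l1_norm_eq_sum[of ?A])
  finally show ?thesis .
qed

lemma l1_norm_add_disjoint:
  assumes "Poly_Mapping.keys x \<inter> Poly_Mapping.keys y = {}"
  shows "l1_norm (x + y) = l1_norm x + l1_norm y"
proof -
  let ?A = "Poly_Mapping.keys x \<union> Poly_Mapping.keys y"
  have "l1_norm (x + y) = (\<Sum>s\<in>?A. nat \<bar>Poly_Mapping.lookup (x + y) s\<bar>)"
    by (intro l1_norm_eq_sum keys_add) simp
  also have "\<dots> = (\<Sum>s\<in>?A. nat \<bar>Poly_Mapping.lookup x s\<bar> + nat \<bar>Poly_Mapping.lookup y s\<bar>)"
    using assms by (intro sum.cong refl) (simp add: lookup_add in_keys_iff disjoint_iff, metis add_0 add.right_neutral abs_zero nat_0)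
  also have "\<dots> = l1_norm x + l1_norm y"
    by (simp add: sum.distrib l1_norm_eq_sum[of ?A])
  finally show ?thesis .
qed

text \<open>Only an inequality, because \<open>f\<close> may merge generators whose coefficients then cancel. For
  a translation the reverse inequality is that of the inverse translation.\<close>

lemma l1_norm_frag_extend_of_le:
  fixes f :: "'a \<Rightarrow> 'b"
  shows "l1_norm (frag_extend (\<lambda>s. frag_of (f s)) x) \<le> l1_norm x"
proof -
  have sum_le: "l1_norm (sum h A) \<le> (\<Sum>a\<in>A. l1_norm (h a))" if "finite A" for h :: "'a \<Rightarrow> 'b \<Rightarrow>\<^sub>0 int" and A
    using that
  proof induction
    case (insert a A)
    then show ?case
      using l1_norm_add_le[of "h a" "sum h A"] by simp
  qed simp
  have "l1_norm (frag_cmul k (frag_of t)) = nat \<bar>k\<bar>" for k and t :: 'b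
    by (subst l1_norm_eq_sum[of "{t}"]) auto
  then show ?thesis
    using sum_le[of "Poly_Mapping.keys x" "\<lambda>s. frag_cmul (Poly_Mapping.lookup x s) (frag_of (f s))"]
    unfolding frag_extend_def l1_norm_def[of x] by simp
qed

lemma card_keys_le_l1_norm: "card (Poly_Mapping.keys x) \<le> l1_norm x"
proof -
  have "(\<Sum>s\<in>Poly_Mapping.keys x. 1) \<le> l1_norm x"
    unfolding l1_norm_def by (intro sum_mono) (auto simp: in_keys_iff)
  then show ?thesis by simp
qed

text \<open>The coefficients of an element of the ball are integers bounded by \<open>n\<close>.\<close>

lemma finite_l1_ball:
  assumes "finite B"
  shows "finite {x. Poly_Mapping.keys x \<subseteq> B \<and> l1_norm x \<le> n}" (is "finite ?X")
proof -
  have "Poly_Mapping.lookup x s \<in> {- int n..int n}" if "x \<in> ?X" for x s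
  proof (cases "s \<in> Poly_Mapping.keys x")
    case True
    then have "nat \<bar>Poly_Mapping.lookup x s\<bar> \<le> l1_norm x"
      unfolding l1_norm_def by (intro member_le_sum) auto
    then show ?thesis using that by auto
  qed (simp add: in_keys_iff)
  moreover have "Poly_Mapping.lookup x s = 0" if "x \<in> ?X" "s \<notin> B" for x s
    using that by (auto simp: in_keys_iff subset_iff)
  ultimately have "Poly_Mapping.lookup ` ?X
      \<subseteq> {f. \<forall>s. (s \<in> B \<longrightarrow> f s \<in> {- int n..int n}) \<and> (s \<notin> B \<longrightarrow> f s = 0)}"
    by blast
  then have "finite (Poly_Mapping.lookup ` ?X)"
    by (rule finite_subset) (intro finite_set_of_finite_funs assms, simp)
  then show ?thesis
    by (rule finite_imageD) (simp add: inj_on_def)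
qed


section \<open>Filling norms\<close>

lemma left_module_homD:
  assumes "h \<in> left_module_hom R M N"
  shows "x \<in> carrier M \<Longrightarrow> h x \<in> carrier N"
    and "x \<in> carrier M \<Longrightarrow> y \<in> carrier M \<Longrightarrow> h (x \<oplus>\<^bsub>M\<^esub> y) = h x \<oplus>\<^bsub>N\<^esub> h y"
    and "a \<in> carrier R \<Longrightarrow> x \<in> carrier M \<Longrightarrow> h (a \<odot>\<^bsub>M\<^esub> x) = a \<odot>\<^bsub>N\<^esub> h x"
  using assms by (auto simp: left_module_hom_def)

text \<open>
  The \<open>\<int>\<close>-coordinates behind the free norm are given by definite description. To compute with them,
  the basis property over the group ring must first be turned into one over \<open>\<int>\<close>: a combination
  \<open>\<Sum> a\<^sub>i \<alpha>\<^sub>i\<close> with \<open>a\<^sub>i\<close> in the group ring is the same thing as an integral combination of the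
  \<open>g \<alpha>\<^sub>i\<close>, the coefficients of the latter being the matrix entries of the family \<open>a\<close>.
\<close>

locale based_free_module = G: group G + F: left_module "group_ring G" F
  for G :: "('g, 'k) monoid_scheme" and F :: "('g \<Rightarrow>\<^sub>0 int, 'f, 'm) module_scheme" +
  fixes I :: "'i set" and \<alpha> :: "'i \<Rightarrow> 'f"
  assumes basis: "finite_basis (group_ring G) F I \<alpha>"
begin

definition zbasis :: "'g \<times> 'i \<Rightarrow> 'f"
  where "zbasis = (\<lambda>(g, i). frag_of g \<odot>\<^bsub>F\<^esub> \<alpha> i)"

definition lin_comb :: "('g \<times> 'i \<Rightarrow>\<^sub>0 int) \<Rightarrow> 'f"
  where "lin_comb c =
    (\<Oplus>\<^bsub>F\<^esub>j\<in>Poly_Mapping.keys c. [Poly_Mapping.lookup c j] \<cdot>\<^bsub>F\<^esub> zbasis j)"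

text \<open>The \<open>i\<close>-th coefficient, as an element of the group ring, of the combination with integral
  coefficients \<open>c\<close>.\<close>

definition row :: "('g \<times> 'i \<Rightarrow>\<^sub>0 int) \<Rightarrow> 'i \<Rightarrow> 'g \<Rightarrow>\<^sub>0 int"
  where "row c i = frag_extend (\<lambda>(g, j). if j = i then frag_of g else 0) c"

lemma carrier_ZG: "carrier (group_ring G) = {a. Poly_Mapping.keys a \<subseteq> carrier G}"
  by (auto simp: group_ring_def)

lemma frag_of_ZG: "g \<in> carrier G \<Longrightarrow> frag_of g \<in> carrier (group_ring G)"
  by (simp add: carrier_ZG)

lemma finite_I: "finite I" and \<alpha>_closed: "i \<in> I \<Longrightarrow> \<alpha> i \<in> carrier F"
  using basis by (auto simp: finite_basis_def)

lemma zbasis_closed: "j \<in> carrier G \<times> I \<Longrightarrow> zbasis j \<in> carrier F"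
  by (auto simp: zbasis_def intro!: F.smult_closed frag_of_ZG \<alpha>_closed)

text \<open>Summing over a common superset of the supports of \<open>c\<close> and \<open>d\<close> is what makes the additivity
  of \<open>lin_comb\<close> a termwise statement.\<close>

lemma lin_comb_superset:
  assumes "finite A" "Poly_Mapping.keys c \<subseteq> A" "A \<subseteq> carrier G \<times> I"
  shows "lin_comb c = (\<Oplus>\<^bsub>F\<^esub>j\<in>A. [Poly_Mapping.lookup c j] \<cdot>\<^bsub>F\<^esub> zbasis j)"
proof -
  have "zbasis j \<in> carrier F" if "j \<in> A" for j
    using assms(3) that zbasis_closed by blast
  then show ?thesis
    unfolding lin_comb_def using assms(1,2)
    by (intro F.M.add.finprod_mono_neutral_cong_left) (auto simp: in_keys_iff add_pow_def[of _ "0::int"])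
qed

lemma lin_comb_closed: "Poly_Mapping.keys c \<subseteq> carrier G \<times> I \<Longrightarrow> lin_comb c \<in> carrier F"
  unfolding lin_comb_def by (intro F.M.finsum_closed) (use zbasis_closed in auto)

lemma lin_comb_add:
  assumes "Poly_Mapping.keys c \<subseteq> carrier G \<times> I" "Poly_Mapping.keys d \<subseteq> carrier G \<times> I"
  shows "lin_comb (c + d) = lin_comb c \<oplus>\<^bsub>F\<^esub> lin_comb d"
proof -
  let ?A = "Poly_Mapping.keys c \<union> Poly_Mapping.keys d"
  have z: "zbasis j \<in> carrier F" if "j \<in> ?A" for j
    using that assms zbasis_closed by blast
  have "lin_comb (c + d) = (\<Oplus>\<^bsub>F\<^esub>j\<in>?A. [Poly_Mapping.lookup (c + d) j] \<cdot>\<^bsub>F\<^esub> zbasis j)"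
    using assms by (intro lin_comb_superset keys_add) auto
  also have "\<dots> = (\<Oplus>\<^bsub>F\<^esub>j\<in>?A. [Poly_Mapping.lookup c j] \<cdot>\<^bsub>F\<^esub> zbasis j
                          \<oplus>\<^bsub>F\<^esub> [Poly_Mapping.lookup d j] \<cdot>\<^bsub>F\<^esub> zbasis j)"
    by (intro F.M.finsum_cong') (auto simp: lookup_add F.M.add.int_pow_mult z)
  also have "\<dots> = (\<Oplus>\<^bsub>F\<^esub>j\<in>?A. [Poly_Mapping.lookup c j] \<cdot>\<^bsub>F\<^esub> zbasis j)
                \<oplus>\<^bsub>F\<^esub> (\<Oplus>\<^bsub>F\<^esub>j\<in>?A. [Poly_Mapping.lookup d j] \<cdot>\<^bsub>F\<^esub> zbasis j)"
    using z by (intro F.M.finsum_addf) auto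
  also have "\<dots> = lin_comb c \<oplus>\<^bsub>F\<^esub> lin_comb d"
    using assms by (simp add: lin_comb_superset[of ?A])
  finally show ?thesis .
qed

lemma lin_comb_frag_of: "j \<in> carrier G \<times> I \<Longrightarrow> lin_comb (frag_of j) = zbasis j"
  using zbasis_closed by (simp add: lin_comb_def)

lemma smult_0_left: "x \<in> carrier F \<Longrightarrow> 0 \<odot>\<^bsub>F\<^esub> x = \<zero>\<^bsub>F\<^esub>"
  using F.smult_l_distr[of 0 0 x] F.smult_closed[of 0 x] by (simp add: group_ring_def)

text \<open>
  The uniqueness half of the universal property of the free abelian group on \<open>J\<close>. It reduces the
  identities for \<open>lin_comb\<close> below to single basis elements.
\<close>

lemma additive_eqI:
  assumes c: "Poly_Mapping.keys c \<subseteq> J"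
    and closed: "\<And>c. Poly_Mapping.keys c \<subseteq> J \<Longrightarrow> f c \<in> carrier F"
                "\<And>c. Poly_Mapping.keys c \<subseteq> J \<Longrightarrow> h c \<in> carrier F"
    and add: "\<And>c d. Poly_Mapping.keys c \<subseteq> J \<Longrightarrow> Poly_Mapping.keys d \<subseteq> J \<Longrightarrow> f (c + d) = f c \<oplus>\<^bsub>F\<^esub> f d"
             "\<And>c d. Poly_Mapping.keys c \<subseteq> J \<Longrightarrow> Poly_Mapping.keys d \<subseteq> J \<Longrightarrow> h (c + d) = h c \<oplus>\<^bsub>F\<^esub> h d"
    and gen: "\<And>j. j \<in> J \<Longrightarrow> f (frag_of j) = h (frag_of j)"
  shows "f c = h c"
proof -
  have "Poly_Mapping.keys c \<subseteq> J \<and> f c = h c"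
    using c
  proof (induction c rule: frag_induction)
    case zero
    have "f 0 = \<zero>\<^bsub>F\<^esub>" "h 0 = \<zero>\<^bsub>F\<^esub>"
      using add[of 0 0] closed[of 0] by simp_all
    then show ?case by simp
  next
    case (one j)
    then show ?case using gen by simp
  next
    case (diff a b)
    have ab: "Poly_Mapping.keys (a - b) \<subseteq> J"
      using diff keys_diff[of a b] by blast
    have "f (a - b) \<oplus>\<^bsub>F\<^esub> f b = h (a - b) \<oplus>\<^bsub>F\<^esub> f b"
      using add[of "a - b" b] ab diff by simp
    then show ?case
      using ab diff closed by (simp add: F.M.add.right_cancel)
  qed
  then show ?thesis ..
qed

lemma keys_row: "Poly_Mapping.keys c \<subseteq> carrier G \<times> I \<Longrightarrow> Poly_Mapping.keys (row c i) \<subseteq> carrier G"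
  unfolding row_def
  by (rule order_trans[OF keys_frag_extend]) (auto split: if_splits)

lemma lookup_row: "Poly_Mapping.lookup (row c i) g = Poly_Mapping.lookup c (g, i)"
  using subset_UNIV
  by (induction c rule: frag_induction)
    (auto simp: row_def frag_extend_diff lookup_minus split: if_splits)

lemma lin_comb_rows:
  assumes "Poly_Mapping.keys c \<subseteq> carrier G \<times> I"
  shows "lin_comb c = (\<Oplus>\<^bsub>F\<^esub>i\<in>I. row c i \<odot>\<^bsub>F\<^esub> \<alpha> i)"
  using assms
proof (rule additive_eqI)
  fix c d :: "'g \<times> 'i \<Rightarrow>\<^sub>0 int"
  assume c: "Poly_Mapping.keys c \<subseteq> carrier G \<times> I"
  have closed: "row e i \<odot>\<^bsub>F\<^esub> \<alpha> i \<in> carrier F"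
    if "Poly_Mapping.keys e \<subseteq> carrier G \<times> I" "i \<in> I" for e i
    using keys_row[OF that(1)] that(2) by (auto simp: carrier_ZG intro!: F.smult_closed \<alpha>_closed)
  then show "(\<Oplus>\<^bsub>F\<^esub>i\<in>I. row c i \<odot>\<^bsub>F\<^esub> \<alpha> i) \<in> carrier F"
    using c by (intro F.M.finsum_closed) auto
  assume d: "Poly_Mapping.keys d \<subseteq> carrier G \<times> I"
  have row_add: "row (c + d) i \<odot>\<^bsub>F\<^esub> \<alpha> i = row c i \<odot>\<^bsub>F\<^esub> \<alpha> i \<oplus>\<^bsub>F\<^esub> row d i \<odot>\<^bsub>F\<^esub> \<alpha> i" if "i \<in> I" for i
    using F.smult_l_distr[of "row c i" "row d i" "\<alpha> i"] keys_row[OF c] keys_row[OF d] \<alpha>_closed[OF that]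
    by (simp add: group_ring_def row_def frag_extend_add)
  have "(\<Oplus>\<^bsub>F\<^esub>i\<in>I. row (c + d) i \<odot>\<^bsub>F\<^esub> \<alpha> i)
      = (\<Oplus>\<^bsub>F\<^esub>i\<in>I. row c i \<odot>\<^bsub>F\<^esub> \<alpha> i \<oplus>\<^bsub>F\<^esub> row d i \<odot>\<^bsub>F\<^esub> \<alpha> i)"
    using closed c d by (intro F.M.finsum_cong') (auto simp: row_add)
  also have "\<dots> = (\<Oplus>\<^bsub>F\<^esub>i\<in>I. row c i \<odot>\<^bsub>F\<^esub> \<alpha> i) \<oplus>\<^bsub>F\<^esub> (\<Oplus>\<^bsub>F\<^esub>i\<in>I. row d i \<odot>\<^bsub>F\<^esub> \<alpha> i)"
    using closed c d by (intro F.M.finsum_addf) auto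
  finally show "(\<Oplus>\<^bsub>F\<^esub>i\<in>I. row (c + d) i \<odot>\<^bsub>F\<^esub> \<alpha> i)
      = (\<Oplus>\<^bsub>F\<^esub>i\<in>I. row c i \<odot>\<^bsub>F\<^esub> \<alpha> i) \<oplus>\<^bsub>F\<^esub> (\<Oplus>\<^bsub>F\<^esub>i\<in>I. row d i \<odot>\<^bsub>F\<^esub> \<alpha> i)" .
next
  fix j assume "j \<in> carrier G \<times> I"
  then obtain g i where j: "j = (g, i)" "g \<in> carrier G" "i \<in> I" by blast
  have "(\<Oplus>\<^bsub>F\<^esub>k\<in>I. row (frag_of j) k \<odot>\<^bsub>F\<^esub> \<alpha> k)
      = (\<Oplus>\<^bsub>F\<^esub>k\<in>I. if i = k then frag_of g \<odot>\<^bsub>F\<^esub> \<alpha> k else \<zero>\<^bsub>F\<^esub>)"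
    using j by (intro F.M.finsum_cong')
      (auto simp: row_def smult_0_left \<alpha>_closed F.smult_closed frag_of_ZG)
  also have "\<dots> = frag_of g \<odot>\<^bsub>F\<^esub> \<alpha> i"
    using j finite_I
    by (intro F.M.add.finprod_singleton) (auto intro!: F.smult_closed frag_of_ZG \<alpha>_closed)
  finally show "lin_comb (frag_of j) = (\<Oplus>\<^bsub>F\<^esub>k\<in>I. row (frag_of j) k \<odot>\<^bsub>F\<^esub> \<alpha> k)"
    using j by (simp add: lin_comb_frag_of zbasis_def)
qed (simp_all add: lin_comb_closed lin_comb_add)

text \<open>The family of rows is the only family of group ring coefficients representing
  \<open>lin_comb c\<close>, and it determines \<open>c\<close>; conversely every family of coefficients consists of the
  rows of some \<open>c\<close>.\<close>

lemma ex1_lin_comb: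
  assumes "x \<in> carrier F"
  shows "\<exists>!c. c \<in> carrier (free_Abelian_group (carrier G \<times> I)) \<and> x = lin_comb c"
proof -
  have "\<exists>!a. a \<in> I \<rightarrow>\<^sub>E carrier (group_ring G) \<and> x = (\<Oplus>\<^bsub>F\<^esub>i\<in>I. a i \<odot>\<^bsub>F\<^esub> \<alpha> i)"
    using basis assms unfolding finite_basis_def by blast
  then obtain a where a: "a \<in> I \<rightarrow>\<^sub>E carrier (group_ring G)" "x = (\<Oplus>\<^bsub>F\<^esub>i\<in>I. a i \<odot>\<^bsub>F\<^esub> \<alpha> i)"
    and a_unique: "\<And>b. b \<in> I \<rightarrow>\<^sub>E carrier (group_ring G)
      \<Longrightarrow> x = (\<Oplus>\<^bsub>F\<^esub>i\<in>I. b i \<odot>\<^bsub>F\<^esub> \<alpha> i) \<Longrightarrow> b = a"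
    by (elim ex1E) blast
  define c where "c = (\<Sum>i\<in>I. frag_extend (\<lambda>g. frag_of (g, i)) (a i))"
  have keys_c: "Poly_Mapping.keys c \<subseteq> carrier G \<times> I"
  proof -
    have "Poly_Mapping.keys (frag_extend (\<lambda>g. frag_of (g, i)) (a i)) \<subseteq> carrier G \<times> I" if "i \<in> I" for i
      by (rule order_trans[OF keys_frag_extend]) (use a(1) that in \<open>auto simp: carrier_ZG\<close>)
    then show ?thesis
      unfolding c_def using keys_sum[of "\<lambda>i. frag_extend (\<lambda>g. frag_of (g, i)) (a i)" I] by blast
  qed
  have row_1: "row (frag_extend (\<lambda>g. frag_of (g, k)) b) i = (if k = i then b else 0)"
    for b :: "'g \<Rightarrow>\<^sub>0 int" and i k
    using subset_UNIV
    by (induction b rule: frag_induction) (auto simp: row_def frag_extend_diff)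
  have row_c: "row c i = a i" if "i \<in> I" for i
  proof -
    have "row c i = (\<Sum>k\<in>I. row (frag_extend (\<lambda>g. frag_of (g, k)) (a k)) i)"
      unfolding c_def row_def by (simp add: frag_extend_sum finite_I o_def)
    then show ?thesis using finite_I that by (simp add: row_1)
  qed
  have "x = (\<Oplus>\<^bsub>F\<^esub>i\<in>I. row c i \<odot>\<^bsub>F\<^esub> \<alpha> i)"
    unfolding a(2) using a(1) row_c
    by (intro F.M.finsum_cong') (auto intro!: F.smult_closed \<alpha>_closed)
  then have x: "x = lin_comb c"
    using lin_comb_rows[OF keys_c] by simp
  have unique: "c = d" if d: "Poly_Mapping.keys d \<subseteq> carrier G \<times> I" "x = lin_comb d" for d
  proof -
    have mem: "restrict (row e) I \<in> I \<rightarrow>\<^sub>E carrier (group_ring G)"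
      "lin_comb e = (\<Oplus>\<^bsub>F\<^esub>i\<in>I. restrict (row e) I i \<odot>\<^bsub>F\<^esub> \<alpha> i)"
      if e: "Poly_Mapping.keys e \<subseteq> carrier G \<times> I" for e
    proof -
      show *: "restrict (row e) I \<in> I \<rightarrow>\<^sub>E carrier (group_ring G)"
        using keys_row[OF e] by (auto simp: carrier_ZG)
      show "lin_comb e = (\<Oplus>\<^bsub>F\<^esub>i\<in>I. restrict (row e) I i \<odot>\<^bsub>F\<^esub> \<alpha> i)"
        unfolding lin_comb_rows[OF e] using keys_row[OF e]
        by (intro F.M.finsum_cong') (auto simp: carrier_ZG intro!: F.smult_closed \<alpha>_closed)
    qed
    have "restrict (row c) I = restrict (row d) I"
      using a_unique[OF mem(1)[OF keys_c] trans[OF x mem(2)[OF keys_c]]]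
        a_unique[OF mem(1)[OF d(1)] trans[OF d(2) mem(2)[OF d(1)]]] by (rule trans[OF _ sym])
    then have "Poly_Mapping.lookup c (g, i) = Poly_Mapping.lookup d (g, i)" if "i \<in> I" for g i
      using that unfolding lookup_row[symmetric] by (metis restrict_apply')
    moreover have "Poly_Mapping.lookup c (g, i) = Poly_Mapping.lookup d (g, i)" if "i \<notin> I" for g i
    proof -
      have "(g, i) \<notin> Poly_Mapping.keys c" "(g, i) \<notin> Poly_Mapping.keys d"
        using keys_c d(1) that by auto
      then show ?thesis by (simp add: in_keys_iff)
    qed
    ultimately show "c = d"
      by (intro poly_mapping_eqI) auto
  qed
  show ?thesis
    using keys_c x unique[symmetric] by (intro ex1I[of _ c]) auto
qed

lemma int_coords_zbasis:
  assumes "x \<in> carrier F"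
  shows "Poly_Mapping.keys (int_coords F (carrier G \<times> I) zbasis x) \<subseteq> carrier G \<times> I"
    and "x = lin_comb (int_coords F (carrier G \<times> I) zbasis x)"
  using theI'[OF ex1_lin_comb[OF assms]] by (simp_all add: int_coords_def lin_comb_def)

lemma int_coords_lin_comb:
  assumes "Poly_Mapping.keys c \<subseteq> carrier G \<times> I"
  shows "int_coords F (carrier G \<times> I) zbasis (lin_comb c) = c"
  unfolding int_coords_def lin_comb_def[symmetric]
  by (rule the1_equality[OF ex1_lin_comb[OF lin_comb_closed[OF assms]]]) (simp add: assms)

lemma free_norm_zbasis: "free_norm G F I \<alpha> x = l1_norm (int_coords F (carrier G \<times> I) zbasis x)"
  by (simp add: free_norm_def zbasis_def)

lemma free_norm_add_le:
  assumes "x \<in> carrier F" "y \<in> carrier F"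
  shows "free_norm G F I \<alpha> (x \<oplus>\<^bsub>F\<^esub> y) \<le> free_norm G F I \<alpha> x + free_norm G F I \<alpha> y"
proof -
  let ?c = "int_coords F (carrier G \<times> I) zbasis"
  note x = int_coords_zbasis[OF assms(1)] and y = int_coords_zbasis[OF assms(2)]
  have "Poly_Mapping.keys (?c x + ?c y) \<subseteq> carrier G \<times> I"
    by (intro order_trans[OF keys_add] Un_least x(1) y(1))
  moreover have "x \<oplus>\<^bsub>F\<^esub> y = lin_comb (?c x + ?c y)"
    using lin_comb_add[OF x(1) y(1)] unfolding x(2)[symmetric] y(2)[symmetric] by (rule sym)
  ultimately have "?c (x \<oplus>\<^bsub>F\<^esub> y) = ?c x + ?c y"
    by (simp only: int_coords_lin_comb)
  then show ?thesis
    by (simp only: free_norm_zbasis l1_norm_add_le)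
qed

text \<open>Translation by \<open>g\<close> permutes the \<open>\<int>\<close>-basis, so it acts on coordinates by relabelling.
  This is why it does not increase the free norm.\<close>

lemma lin_comb_translate:
  assumes g: "g \<in> carrier G" and c: "Poly_Mapping.keys c \<subseteq> carrier G \<times> I"
  defines "t \<equiv> frag_extend (\<lambda>j. frag_of (g \<otimes>\<^bsub>G\<^esub> fst j, snd j))"
  shows "Poly_Mapping.keys (t c) \<subseteq> carrier G \<times> I" "lin_comb (t c) = frag_of g \<odot>\<^bsub>F\<^esub> lin_comb c"
proof -
  have keys_t: "Poly_Mapping.keys (t c) \<subseteq> carrier G \<times> I"
    if "Poly_Mapping.keys c \<subseteq> carrier G \<times> I" for c
    unfolding t_def by (rule order_trans[OF keys_frag_extend]) (use g that in auto)
  then show "Poly_Mapping.keys (t c) \<subseteq> carrier G \<times> I"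
    using c .
  show "lin_comb (t c) = frag_of g \<odot>\<^bsub>F\<^esub> lin_comb c"
    using c
  proof (rule additive_eqI)
    fix c d :: "'g \<times> 'i \<Rightarrow>\<^sub>0 int"
    assume c: "Poly_Mapping.keys c \<subseteq> carrier G \<times> I"
    show "lin_comb (t c) \<in> carrier F" "frag_of g \<odot>\<^bsub>F\<^esub> lin_comb c \<in> carrier F"
      using c g by (simp_all add: lin_comb_closed keys_t F.smult_closed frag_of_ZG)
    assume d: "Poly_Mapping.keys d \<subseteq> carrier G \<times> I"
    show "lin_comb (t (c + d)) = lin_comb (t c) \<oplus>\<^bsub>F\<^esub> lin_comb (t d)"
      using lin_comb_add[OF keys_t keys_t, OF c d] by (simp add: t_def frag_extend_add)
    show "frag_of g \<odot>\<^bsub>F\<^esub> lin_comb (c + d) = frag_of g \<odot>\<^bsub>F\<^esub> lin_comb c \<oplus>\<^bsub>F\<^esub> frag_of g \<odot>\<^bsub>F\<^esub> lin_comb d"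
      using c d g by (simp add: lin_comb_add lin_comb_closed F.smult_r_distr frag_of_ZG)
  next
    fix j assume "j \<in> carrier G \<times> I"
    then obtain h i where j: "j = (h, i)" "h \<in> carrier G" "i \<in> I" by blast
    have "frag_of (g \<otimes>\<^bsub>G\<^esub> h) \<odot>\<^bsub>F\<^esub> \<alpha> i = frag_of g \<odot>\<^bsub>F\<^esub> (frag_of h \<odot>\<^bsub>F\<^esub> \<alpha> i)"
      using F.smult_assoc[OF frag_of_ZG frag_of_ZG, of g h "\<alpha> i"] g j \<alpha>_closed
      by (simp add: group_ring_def)
    then show "lin_comb (t (frag_of j)) = frag_of g \<odot>\<^bsub>F\<^esub> lin_comb (frag_of j)"
      using g j by (simp add: t_def lin_comb_frag_of zbasis_def)
  qed
qed

lemma free_norm_translate_le: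
  assumes "g \<in> carrier G" "x \<in> carrier F"
  shows "free_norm G F I \<alpha> (frag_of g \<odot>\<^bsub>F\<^esub> x) \<le> free_norm G F I \<alpha> x"
proof -
  let ?c = "int_coords F (carrier G \<times> I) zbasis"
  note x = int_coords_zbasis[OF assms(2)]
  note t = lin_comb_translate[OF assms(1) x(1)]
  have "?c (frag_of g \<odot>\<^bsub>F\<^esub> x) = frag_extend (\<lambda>j. frag_of (g \<otimes>\<^bsub>G\<^esub> fst j, snd j)) (?c x)"
    using int_coords_lin_comb[OF t(1)] unfolding t(2) x(2)[symmetric] .
  then show ?thesis
    by (simp only: free_norm_zbasis l1_norm_frag_extend_of_le)
qed

lemma filling_norm_le: "x \<in> carrier F \<Longrightarrow> filling_norm G F I \<alpha> \<eta> (\<eta> x) \<le> free_norm G F I \<alpha> x"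
  unfolding filling_norm_def by (rule Least_le) blast

text \<open>The minimum in the filling norm is taken over a nonempty set, since \<open>m\<close> has a preimage;
  choosing preimages of minimal norm turns the estimates for the free norm into estimates for the
  filling norm.\<close>

lemma filling_norm_attained:
  assumes "m \<in> \<eta> ` carrier F"
  obtains x where "x \<in> carrier F" "\<eta> x = m" "filling_norm G F I \<alpha> \<eta> m = free_norm G F I \<alpha> x"
proof -
  have "\<exists>n. \<exists>x\<in>carrier F. \<eta> x = m \<and> n = free_norm G F I \<alpha> x"
    using assms by blast
  from LeastI_ex[OF this, folded filling_norm_def] show ?thesis
    using that by blast
qed

lemma filling_norm_add_le:
  assumes "\<eta> \<in> left_module_hom (group_ring G) F K" "\<eta> ` carrier F = carrier K"
    and "m \<in> carrier K" "m' \<in> carrier K"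
  shows "filling_norm G F I \<alpha> \<eta> (m \<oplus>\<^bsub>K\<^esub> m') \<le> filling_norm G F I \<alpha> \<eta> m + filling_norm G F I \<alpha> \<eta> m'"
proof -
  obtain x where x: "x \<in> carrier F" "\<eta> x = m" "filling_norm G F I \<alpha> \<eta> m = free_norm G F I \<alpha> x"
    by (rule filling_norm_attained[of m \<eta>]) (use assms in auto)
  obtain y where y: "y \<in> carrier F" "\<eta> y = m'" "filling_norm G F I \<alpha> \<eta> m' = free_norm G F I \<alpha> y"
    by (rule filling_norm_attained[of m' \<eta>]) (use assms in auto)
  have "m \<oplus>\<^bsub>K\<^esub> m' = \<eta> (x \<oplus>\<^bsub>F\<^esub> y)"
    using left_module_homD(2)[OF assms(1) x(1) y(1)] x(2) y(2) by simp
  then show ?thesis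
    using filling_norm_le[of "x \<oplus>\<^bsub>F\<^esub> y" \<eta>] free_norm_add_le[OF x(1) y(1)] x(1,3) y(1,3)
    by simp
qed

lemma filling_norm_translate_le:
  assumes "\<eta> \<in> left_module_hom (group_ring G) F K" "\<eta> ` carrier F = carrier K"
    and "g \<in> carrier G" "m \<in> carrier K"
  shows "filling_norm G F I \<alpha> \<eta> (frag_of g \<odot>\<^bsub>K\<^esub> m) \<le> filling_norm G F I \<alpha> \<eta> m"
proof -
  obtain x where x: "x \<in> carrier F" "\<eta> x = m" "filling_norm G F I \<alpha> \<eta> m = free_norm G F I \<alpha> x"
    by (rule filling_norm_attained[of m \<eta>]) (use assms in auto)
  have "frag_of g \<odot>\<^bsub>K\<^esub> m = \<eta> (frag_of g \<odot>\<^bsub>F\<^esub> x)"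
    using left_module_homD(3)[OF assms(1) frag_of_ZG[OF assms(3)] x(1)] x(2) by simp
  then show ?thesis
    using filling_norm_le[of "frag_of g \<odot>\<^bsub>F\<^esub> x" \<eta>] free_norm_translate_le[of g x] x(1,3) assms(3)
    by (simp add: F.smult_closed frag_of_ZG)
qed

end

section \<open>Splitting small cycles into translates of finitely many\<close>

locale permutation_module_hom =
  S: group_action G S \<phi> + T: group_action G T \<psi>
  for G :: "('g, 'k) monoid_scheme" and S :: "'s set" and \<phi> :: "'g \<Rightarrow> 's \<Rightarrow> 's"
    and T :: "'t set" and \<psi> :: "'g \<Rightarrow> 't \<Rightarrow> 't" +
  fixes \<rho> :: "('s \<Rightarrow>\<^sub>0 int) \<Rightarrow> ('t \<Rightarrow>\<^sub>0 int)"
  assumes hom: "\<rho> \<in> left_module_hom (group_ring G) (permutation_module S \<phi>) (permutation_module T \<psi>)"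
begin

abbreviation supp :: "'s \<Rightarrow> 't set"
  where "supp s \<equiv> Poly_Mapping.keys (\<rho> (frag_of s))"

abbreviation cycles :: "('s \<Rightarrow>\<^sub>0 int) set"
  where "cycles \<equiv> {x. Poly_Mapping.keys x \<subseteq> S \<and> \<rho> x = 0}"

abbreviation shift :: "'g \<Rightarrow> ('s \<Rightarrow>\<^sub>0 int) \<Rightarrow> ('s \<Rightarrow>\<^sub>0 int)"
  where "shift g \<equiv> frag_bilinear \<phi> (frag_of g)"

text \<open>The closed neighbourhood of \<open>A\<close> in the graph on \<open>S\<close> that has an edge between two points
  when the supports of their images meet. Points that \<open>\<rho>\<close> maps to zero are isolated, and \<open>A\<close> has to
  be added by hand to retain them.\<close>

definition thicken :: "'s set \<Rightarrow> 's set"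
  where "thicken A = A \<union> {s \<in> S. \<exists>a\<in>A. supp a \<inter> supp s \<noteq> {}}"

lemma carrier_kernel:
  "carrier (kernel_module (permutation_module S \<phi>) (permutation_module T \<psi>) \<rho>) = cycles"
  by (auto simp: kernel_module_def a_kernel_def' permutation_module_def)

lemma keys_\<rho>: "Poly_Mapping.keys x \<subseteq> S \<Longrightarrow> Poly_Mapping.keys (\<rho> x) \<subseteq> T"
  using left_module_homD(1)[OF hom, of x] by (simp add: permutation_module_def)

lemma \<rho>_add:
  "Poly_Mapping.keys x \<subseteq> S \<Longrightarrow> Poly_Mapping.keys y \<subseteq> S \<Longrightarrow> \<rho> (x + y) = \<rho> x + \<rho> y"
  using left_module_homD(2)[OF hom, of x y] by (simp add: permutation_module_def)

lemma \<rho>_shift: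
  "g \<in> carrier G \<Longrightarrow> Poly_Mapping.keys x \<subseteq> S \<Longrightarrow>
    \<rho> (shift g x) = frag_bilinear \<psi> (frag_of g) (\<rho> x)"
  using left_module_homD(3)[OF hom, of "frag_of g" x]
  by (simp add: permutation_module_def group_ring_def)

lemma keys_\<rho>_subset:
  assumes "Poly_Mapping.keys x \<subseteq> S"
  shows "Poly_Mapping.keys (\<rho> x) \<subseteq> (\<Union>s\<in>Poly_Mapping.keys x. supp s)"
proof -
  have "Poly_Mapping.keys x \<subseteq> S \<and> \<rho> x = frag_extend (\<lambda>s. \<rho> (frag_of s)) x"
    using assms
  proof (induction x rule: frag_induction)
    case zero
    then show ?case using \<rho>_add[of 0 0] by simp
  next
    case (one s)
    then show ?case by simp
  next
    case (diff a b)
    then have "Poly_Mapping.keys (a - b) \<subseteq> S"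
      using keys_diff[of a b] by blast
    with diff \<rho>_add[of "a - b" b] show ?case
      by (simp add: frag_extend_diff)
  qed
  then show ?thesis
    using keys_frag_extend[of "\<lambda>s. \<rho> (frag_of s)" x] by simp
qed

lemma shift_eq: "shift g x = frag_extend (\<lambda>s. frag_of (\<phi> g s)) x"
  by (simp add: frag_bilinear_def)

lemma keys_shift_subset: "Poly_Mapping.keys (shift g x) \<subseteq> \<phi> g ` Poly_Mapping.keys x"
  unfolding shift_eq by (rule order_trans[OF keys_frag_extend]) auto

lemma shift_inv:
  assumes "g \<in> carrier G" "Poly_Mapping.keys x \<subseteq> S"
  shows "shift g (shift (inv\<^bsub>G\<^esub> g) x) = x"
proof -
  interpret group G
    using S.group_hom by (simp add: group_hom_def)
  have "shift g (shift (inv\<^bsub>G\<^esub> g) x) = frag_bilinear \<phi> (frag_of (g \<otimes>\<^bsub>G\<^esub> inv\<^bsub>G\<^esub> g)) x"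
    using assms S.composition_rule
    by (subst frag_bilinear_assoc[where m = "mult G" and A = "carrier G" and X = S, symmetric]) auto
  also have "\<dots> = x"
  proof -
    have "\<phi> \<one>\<^bsub>G\<^esub> s = s" if "s \<in> S" for s
      using fun_cong[OF S.id_eq_one, of s] that by simp
    then show ?thesis
      using assms by (simp add: frag_bilinear_left_id[of x S])
  qed
  finally show ?thesis .
qed

lemma shift_cycle:
  assumes "g \<in> carrier G" "x \<in> cycles"
  shows "shift g x \<in> cycles"
proof -
  have "\<phi> g ` Poly_Mapping.keys x \<subseteq> S"
    using assms S.element_image by blast
  then show ?thesis
    using assms keys_shift_subset[of g x] by (auto simp: \<rho>_shift)
qed

lemma l1_norm_shift_le: "l1_norm (shift g x) \<le> l1_norm x"
  unfolding shift_eq by (rule l1_norm_frag_extend_of_le)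

text \<open>The elements moving \<open>t\<close> to \<open>u\<close> form a left coset of the stabilizer of \<open>t\<close>, unless there
  are none.\<close>

lemma finite_transporter:
  assumes "t \<in> T" "finite (stabilizer G \<psi> t)"
  shows "finite {g \<in> carrier G. \<psi> g t = u}"
proof (cases "\<exists>h\<in>carrier G. \<psi> h t = u")
  case True
  then obtain h where h: "h \<in> carrier G" "\<psi> h t = u" by blast
  interpret group G
    using S.group_hom by (simp add: group_hom_def)
  have "g \<in> (\<lambda>k. h \<otimes>\<^bsub>G\<^esub> k) ` stabilizer G \<psi> t" if g: "g \<in> carrier G" "\<psi> g t = u" for g
  proof (rule image_eqI[of _ _ "inv\<^bsub>G\<^esub> h \<otimes>\<^bsub>G\<^esub> g"])
    have "\<psi> (inv\<^bsub>G\<^esub> h \<otimes>\<^bsub>G\<^esub> g) t = \<psi> (inv\<^bsub>G\<^esub> h \<otimes>\<^bsub>G\<^esub> h) t"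
      using g h T.composition_rule[OF assms(1) inv_closed[OF h(1)]] by metis
    also have "\<dots> = t"
      using h(1) fun_cong[OF T.id_eq_one, of t] assms(1) by simp
    finally show "inv\<^bsub>G\<^esub> h \<otimes>\<^bsub>G\<^esub> g \<in> stabilizer G \<psi> t"
      using g h by (simp add: stabilizer_def)
    show "g = h \<otimes>\<^bsub>G\<^esub> (inv\<^bsub>G\<^esub> h \<otimes>\<^bsub>G\<^esub> g)"
      using g h by (simp add: m_assoc[symmetric])
  qed
  then have "{g \<in> carrier G. \<psi> g t = u} \<subseteq> (\<lambda>k. h \<otimes>\<^bsub>G\<^esub> k) ` stabilizer G \<psi> t"
    by blast
  then show ?thesis
    using assms(2) finite_surj by blast
next
  case False
  then have "{g \<in> carrier G. \<psi> g t = u} = {}" by blast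
  then show ?thesis by (simp only: finite.emptyI)
qed

lemma finite_orbit_representatives:
  assumes "finite (orbits G S \<phi>)"
  obtains R where "finite R" "R \<subseteq> S" "S \<subseteq> (\<Union>r\<in>R. orbit G \<phi> r)"
proof -
  from assms obtain R where R: "R \<subseteq> S" "finite R" "orbits G S \<phi> = orbit G \<phi> ` R"
    using finite_subset_image[of "orbits G S \<phi>" "orbit G \<phi>" S] unfolding orbits_def by blast
  have "s \<in> (\<Union>r\<in>R. orbit G \<phi> r)" if "s \<in> S" for s
  proof -
    have "orbit G \<phi> s \<in> orbit G \<phi> ` R"
      using that R(3) by (auto simp: orbits_def)
    then obtain r where "r \<in> R" "orbit G \<phi> s = orbit G \<phi> r" by blast
    then show ?thesis
      using S.orbit_refl[OF that] by blast
  qed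
  then show ?thesis
    using that[of R] R(1,2) by blast
qed

text \<open>This is where both finiteness assumptions enter: up to translation there are finitely many
  supports, and only finitely many translates of a given one contain a given \<open>u\<close>.\<close>

lemma finite_thicken:
  assumes "finite (orbits G S \<phi>)" and stab: "\<And>t. t \<in> T \<Longrightarrow> finite (stabilizer G \<psi> t)"
    and "finite A"
  shows "finite (thicken A)"
proof -
  obtain R where R: "finite R" "R \<subseteq> S" "S \<subseteq> (\<Union>r\<in>R. orbit G \<phi> r)"
    by (rule finite_orbit_representatives[OF assms(1)])
  have supp_T: "supp r \<subseteq> T" if "r \<in> R" for r
    using keys_\<rho>[of "frag_of r"] R(2) that by auto
  have "finite {s \<in> S. u \<in> supp s}" for u
  proof -
    have "s \<in> (\<Union>r\<in>R. \<Union>t\<in>supp r. (\<lambda>g. \<phi> g r) ` {g \<in> carrier G. \<psi> g t = u})"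
      if s: "s \<in> S" "u \<in> supp s" for s
    proof -
      obtain r g where g: "r \<in> R" "g \<in> carrier G" "s = \<phi> g r"
        using R(3) s(1) by (auto simp: orbit_def)
      then have "\<rho> (frag_of s) = frag_bilinear \<psi> (frag_of g) (\<rho> (frag_of r))"
        using R(2) \<rho>_shift[of g "frag_of r"] by auto
      also have "\<dots> = frag_extend (\<lambda>t. frag_of (\<psi> g t)) (\<rho> (frag_of r))"
        by (simp add: frag_bilinear_def)
      finally have "u \<in> \<psi> g ` supp r"
        using s(2) keys_frag_extend[of "\<lambda>t. frag_of (\<psi> g t)" "\<rho> (frag_of r)"] by auto
      with g show ?thesis by blast
    qed
    then have "{s \<in> S. u \<in> supp s}
        \<subseteq> (\<Union>r\<in>R. \<Union>t\<in>supp r. (\<lambda>g. \<phi> g r) ` {g \<in> carrier G. \<psi> g t = u})"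
      by blast
    moreover have "finite (\<Union>r\<in>R. \<Union>t\<in>supp r. (\<lambda>g. \<phi> g r) ` {g \<in> carrier G. \<psi> g t = u})"
      using R(1) supp_T
      by (intro finite_UN_I finite_imageI finite_keys finite_transporter stab) blast+
    ultimately show ?thesis
      by (rule finite_subset)
  qed
  moreover have "thicken A \<subseteq> A \<union> (\<Union>a\<in>A. \<Union>u\<in>supp a. {s \<in> S. u \<in> supp s})"
    by (auto simp: thicken_def)
  ultimately show ?thesis
    using assms(3) by (elim finite_subset) auto
qed

text \<open>The hypothesis says that no edge leads from the part of the support of \<open>x\<close> inside \<open>A\<close> to
  the part outside. The images of the two parts then have disjoint supports, so they can only
  cancel if both vanish.\<close>

lemma split_cycle:
  assumes x: "x \<in> cycles"
    and closed: "Poly_Mapping.keys x \<inter> thicken A \<subseteq> A"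
  obtains y z where "y \<in> cycles" "z \<in> cycles" "x = y + z"
    "Poly_Mapping.keys y = Poly_Mapping.keys x \<inter> A" "l1_norm x = l1_norm y + l1_norm z"
proof -
  have "Poly_Mapping.keys x \<subseteq> (Poly_Mapping.keys x \<inter> A) \<union> (Poly_Mapping.keys x - A)"
    by blast
  then obtain y z where yz: "Poly_Mapping.keys y \<subseteq> Poly_Mapping.keys x \<inter> A"
      "Poly_Mapping.keys z \<subseteq> Poly_Mapping.keys x - A" "y + z = x"
    by (rule frag_split)
  have S: "Poly_Mapping.keys y \<subseteq> S" "Poly_Mapping.keys z \<subseteq> S"
    using yz(1,2) x by blast+
  have "supp a \<inter> supp b = {}" if "a \<in> Poly_Mapping.keys y" "b \<in> Poly_Mapping.keys z" for a b
  proof (rule ccontr)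
    assume "supp a \<inter> supp b \<noteq> {}"
    moreover have "a \<in> A" "b \<in> S"
      using that yz(1) S(2) by blast+
    ultimately have "b \<in> thicken A"
      by (auto simp only: thicken_def)
    then show False
      using that(2) yz(2) closed by blast
  qed
  then have disjoint: "Poly_Mapping.keys (\<rho> y) \<inter> Poly_Mapping.keys (\<rho> z) = {}"
    using keys_\<rho>_subset[OF S(1)] keys_\<rho>_subset[OF S(2)] by blast
  have sum_0: "\<rho> y + \<rho> z = 0"
    using x \<rho>_add[OF S] unfolding yz(3) by simp
  then have "\<rho> z = - \<rho> y"
    by (simp add: eq_neg_iff_add_eq_0 add.commute)
  then have "\<rho> y = 0"
    using disjoint by simp
  with sum_0 have "\<rho> z = 0"
    by simp
  have dis: "Poly_Mapping.keys y \<inter> Poly_Mapping.keys z = {}"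
    using yz(1,2) by blast
  have "Poly_Mapping.keys x \<inter> A \<subseteq> Poly_Mapping.keys y"
    using keys_add[of y z] yz(2) unfolding yz(3) by blast
  then have "Poly_Mapping.keys y = Poly_Mapping.keys x \<inter> A"
    using yz(1) by blast
  then show ?thesis
    using S \<open>\<rho> y = 0\<close> \<open>\<rho> z = 0\<close> l1_norm_add_disjoint[OF dis] unfolding yz(3)
    by (intro that[of y z]) (simp_all add: yz(3))
qed

text \<open>Otherwise each of the \<open>n + 1\<close> thickening steps would capture at least one new point of the
  support of \<open>x\<close>.\<close>

lemma thicken_stabilises:
  assumes "card (Poly_Mapping.keys x) \<le> n"
  shows "\<exists>k\<le>n. Poly_Mapping.keys x \<inter> (thicken ^^ Suc k) A \<subseteq> (thicken ^^ k) A"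
proof (rule ccontr)
  assume "\<not> ?thesis"
  then have *: "\<not> Poly_Mapping.keys x \<inter> (thicken ^^ Suc k) A \<subseteq> (thicken ^^ k) A" if "k \<le> n" for k
    using that by blast
  have "k \<le> card (Poly_Mapping.keys x \<inter> (thicken ^^ k) A)" if "k \<le> Suc n" for k
    using that
  proof (induction k)
    case (Suc k)
    have "(thicken ^^ k) A \<subseteq> (thicken ^^ Suc k) A"
      by (auto simp: thicken_def)
    then have "Poly_Mapping.keys x \<inter> (thicken ^^ k) A \<subset> Poly_Mapping.keys x \<inter> (thicken ^^ Suc k) A"
      using *[of k] Suc.prems by (simp only: Suc_le_mono) blast
    then have "card (Poly_Mapping.keys x \<inter> (thicken ^^ k) A)
        < card (Poly_Mapping.keys x \<inter> (thicken ^^ Suc k) A)"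
      by (intro psubset_card_mono) auto
    then show ?case
      using Suc by simp
  qed simp
  from this[of "Suc n"] have "Suc n \<le> card (Poly_Mapping.keys x)"
    by (meson Int_lower1 card_mono finite_keys le_refl order_trans)
  then show False
    using assms by simp
qed

lemma thicken_mono_power: "k \<le> n \<Longrightarrow> (thicken ^^ k) A \<subseteq> (thicken ^^ n) A"
  by (rule lift_Suc_mono_le[of "\<lambda>k. (thicken ^^ k) A"]) (auto simp: thicken_def)

section \<open>Boundedness of subadditive functions on small cycles\<close>

text \<open>
  In the induction step, the bound on norm \<open>n + 1\<close> is the bound \<open>B\<close> on norm \<open>n\<close> plus a bound
  \<open>C\<close> for \<open>\<nu>\<close> on the finite set of elements of norm at most \<open>n + 1\<close> supported near the orbit
  representatives. The cycle \<open>0\<close>, from which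
  nothing can be split off, is the reason for the additional term \<open>\<nu> 0\<close>.
\<close>

lemma bounded_on_l1_balls:
  fixes \<nu> :: "('s \<Rightarrow>\<^sub>0 int) \<Rightarrow> nat"
  assumes fin: "finite (orbits G S \<phi>)" "\<And>t. t \<in> T \<Longrightarrow> finite (stabilizer G \<psi> t)"
    and add: "\<And>x y. x \<in> cycles \<Longrightarrow> y \<in> cycles \<Longrightarrow> \<nu> (x + y) \<le> \<nu> x + \<nu> y"
    and shift: "\<And>g x. g \<in> carrier G \<Longrightarrow> x \<in> cycles \<Longrightarrow> \<nu> (shift g x) \<le> \<nu> x"
  shows "\<exists>B. \<forall>x\<in>cycles. l1_norm x \<le> n \<longrightarrow> \<nu> x \<le> B"
proof (induction n)
  case 0
  show ?case by auto
next
  case (Suc n)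
  then obtain B where B: "\<And>x. x \<in> cycles \<Longrightarrow> l1_norm x \<le> n \<Longrightarrow> \<nu> x \<le> B"
    by blast
  obtain R where R: "finite R" "R \<subseteq> S" "S \<subseteq> (\<Union>r\<in>R. orbit G \<phi> r)"
    by (rule finite_orbit_representatives[OF fin(1)])
  define N where "N k = (thicken ^^ k) R" for k
  have "finite (N k)" for k
    by (induction k) (auto simp: N_def R(1) intro!: finite_thicken fin)
  then have "finite {y. Poly_Mapping.keys y \<subseteq> N (Suc n) \<and> l1_norm y \<le> Suc n}"
    by (rule finite_l1_ball)
  then have "finite (\<nu> ` {y. Poly_Mapping.keys y \<subseteq> N (Suc n) \<and> l1_norm y \<le> Suc n})"
    by (rule finite_imageI)
  then obtain C where C: "\<And>y. Poly_Mapping.keys y \<subseteq> N (Suc n) \<Longrightarrow> l1_norm y \<le> Suc n \<Longrightarrow> \<nu> y \<le> C"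
    by (auto simp: finite_nat_set_iff_bounded_le)
  have "\<nu> x \<le> \<nu> 0 + B + C" if x: "x \<in> cycles" "l1_norm x \<le> Suc n" for x
  proof (cases "x = 0")
    case False
    then obtain s where s: "s \<in> Poly_Mapping.keys x"
      by fastforce
    then have "s \<in> S"
      using x(1) by blast
    then obtain r g where g: "r \<in> R" "g \<in> carrier G" "s = \<phi> g r"
      using R(3) by (auto simp: orbit_def)
    interpret group G
      using S.group_hom by (simp add: group_hom_def)
    \<comment> \<open>Translate \<open>x\<close> so that its support meets the representatives; \<open>\<nu>\<close> of the translate bounds
      \<open>\<nu> x\<close> because \<open>x\<close> is itself a translate of it.\<close>
    define x' where "x' = shift (inv\<^bsub>G\<^esub> g) x"
    have x': "x' \<in> cycles" "l1_norm x' \<le> Suc n" "x = shift g x'"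
      using shift_cycle[of "inv\<^bsub>G\<^esub> g" x] l1_norm_shift_le[of "inv\<^bsub>G\<^esub> g" x] shift_inv[of g x] g(2) x
      by (auto simp: x'_def)
    have r: "r \<in> Poly_Mapping.keys x'"
    proof -
      have "s \<in> \<phi> g ` Poly_Mapping.keys x'"
        using keys_shift_subset[of g x'] s unfolding x'(3)[symmetric] by (rule subsetD)
      then obtain r' where "r' \<in> Poly_Mapping.keys x'" "\<phi> g r = \<phi> g r'"
        unfolding g(3) by (rule imageE)
      moreover from this have "r = r'"
        using S.inj_prop[OF g(2)] g(1) R(2) x'(1) by (auto simp: inj_on_def)
      ultimately show ?thesis by simp
    qed
    have "card (Poly_Mapping.keys x') \<le> Suc n"
      using card_keys_le_l1_norm[of x'] x'(2) by simp
    then obtain k where k: "k \<le> Suc n" "Poly_Mapping.keys x' \<inter> thicken (N k) \<subseteq> N k"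
      using thicken_stabilises[of x' "Suc n" R] by (auto simp: N_def)
    obtain y z where yz: "y \<in> cycles" "z \<in> cycles" "x' = y + z"
        "Poly_Mapping.keys y = Poly_Mapping.keys x' \<inter> N k" "l1_norm x' = l1_norm y + l1_norm z"
      by (rule split_cycle[OF x'(1) k(2)])
    \<comment> \<open>The ball contains a point of the support, so the part split off is nonzero and the norm
      of the remaining part drops.\<close>
    have "r \<in> N k"
      using thicken_mono_power[of 0 k R] g(1) by (auto simp: N_def)
    then have "y \<noteq> 0"
      using r yz(4) by auto
    then have "l1_norm y > 0"
      by (simp only: neq0_conv[symmetric] l1_norm_eq_0_iff not_False_eq_True)
    then have "\<nu> z \<le> B"
      using B[of z] yz(2,5) x'(2) by simp
    moreover have "\<nu> y \<le> C"
      using C[of y] yz(4,5) x'(2) thicken_mono_power[OF k(1), of R] by (auto simp: N_def)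
    moreover have "\<nu> x \<le> \<nu> y + \<nu> z"
      using shift[OF g(2) x'(1)] add[OF yz(1,2)] unfolding x'(3)[symmetric] yz(3)[symmetric] by simp
    ultimately show ?thesis by simp
  qed simp
  then show ?case by blast
qed

end

section \<open>Finiteness of the filling function\<close>

theorem proposition2p4:
  fixes G :: "('g, 'k) monoid_scheme"
    and S :: "'s set" and T :: "'t set"
    and \<phi> :: "'g \<Rightarrow> 's \<Rightarrow> 's" and \<psi> :: "'g \<Rightarrow> 't \<Rightarrow> 't"
    and \<rho> :: "('s \<Rightarrow>\<^sub>0 int) \<Rightarrow> ('t \<Rightarrow>\<^sub>0 int)"
    and F :: "('g \<Rightarrow>\<^sub>0 int, 'f, 'm) module_scheme"
    and I :: "'i set" and \<alpha> :: "'i \<Rightarrow> 'f" and \<eta> :: "'f \<Rightarrow> ('s \<Rightarrow>\<^sub>0 int)"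
  defines "K \<equiv> kernel_module (permutation_module S \<phi>) (permutation_module T \<psi>) \<rho>"
  assumes "group G"
    and "group_action G S \<phi>" and "group_action G T \<psi>"
    and "\<rho> \<in> left_module_hom (group_ring G) (permutation_module S \<phi>) (permutation_module T \<psi>)"
    and "finite (orbits G S \<phi>)" and "finite (orbits G T \<psi>)"
    and "\<And>t. t \<in> T \<Longrightarrow> finite (stabilizer G \<psi> t)"
    and "fin_gen_module (group_ring G) K"
    and "left_module (group_ring G) F" and "finite_basis (group_ring G) F I \<alpha>"
    and "\<eta> \<in> left_module_hom (group_ring G) F K" and "\<eta> ` carrier F = carrier K"
  shows "\<forall>n. FV (permutation_module S \<phi>) (permutation_module T \<psi>) \<rho> (filling_norm G F I \<alpha> \<eta>) n < \<infinity>"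
proof
  fix n
  interpret permutation_module_hom G S \<phi> T \<psi> \<rho>
    by (intro permutation_module_hom.intro permutation_module_hom_axioms.intro assms)
  interpret F: based_free_module G F I \<alpha>
    by (intro based_free_module.intro based_free_module_axioms.intro assms)
  let ?\<nu> = "filling_norm G F I \<alpha> \<eta>"
  have carrier_K: "carrier K = cycles"
    by (simp add: K_def carrier_kernel)
  have add_K: "x \<oplus>\<^bsub>K\<^esub> y = x + y" and smult_K: "a \<odot>\<^bsub>K\<^esub> x = frag_bilinear \<phi> a x" for x y a
    by (simp_all add: K_def kernel_module_def permutation_module_def)
  have "\<exists>B. \<forall>x\<in>cycles. l1_norm x \<le> n \<longrightarrow> ?\<nu> x \<le> B"
  proof (rule bounded_on_l1_balls)
    show "?\<nu> (x + y) \<le> ?\<nu> x + ?\<nu> y" if "x \<in> cycles" "y \<in> cycles" for x y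
      using F.filling_norm_add_le[OF assms(12,13), of x y] that
      unfolding carrier_K add_K by blast
    show "?\<nu> (frag_bilinear \<phi> (frag_of g) x) \<le> ?\<nu> x" if "g \<in> carrier G" "x \<in> cycles" for g x
      using F.filling_norm_translate_le[OF assms(12,13), of g x] that
      unfolding carrier_K smult_K by blast
  qed (fact assms)+
  then obtain B where B: "\<And>x. x \<in> cycles \<Longrightarrow> l1_norm x \<le> n \<Longrightarrow> ?\<nu> x \<le> B"
    by blast
  have "FV (permutation_module S \<phi>) (permutation_module T \<psi>) \<rho> ?\<nu> n \<le> enat B"
    unfolding FV_def carrier_kernel by (rule SUP_least) (use B in auto)
  then show "FV (permutation_module S \<phi>) (permutation_module T \<psi>) \<rho> ?\<nu> n < \<infinity>"
    by (rule order_le_less_trans) simp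
qed

end
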